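(* Let $X$ be a real Banach space, let $f:X\to\mathbb{R}$ be locally Lipschitz continuous and let $A\subset X$ be compact such that $0\notin\partial f(x)$ for all $x\in A$. Then there exist $\varepsilon>0$ and $\sigma>0$ such that $$\min\big\{\|a\|\;\big|\;a\in\partial f\big(\overline{B_\varepsilon(x)}\big)\big\}\ge\sigma\quad\text{for all } x\in A.$$
   Context: $X^*$ is the dual of $X$, $\langle\cdot,\cdot\rangle$ the duality pairing, and $\overline{B_\varepsilon(x)}$ the closed ball of radius $\varepsilon$ about $x$. For $f$ Lipschitz near $x$, Clarke's generalized directional derivative is $f^0(x;h)=\limsup_{y\to x,\,t\downarrow 0}\frac{f(y+th)-f(y)}{t}$ and Clarke's generalized gradient is $\partial f(x)=\{a\in X^*\mid\langle a,h\rangle\le f^0(x;h)\ \forall h\in X\}$. For nonempty $A\subset X$, the gradient of $f$ on $A$ is $\partial f(A):=\overline{\operatorname{conv}}^*\bigcup_{y\in A}\partial f(y)$ (the weak$^*$ closure of the convex hull). *)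

theory Defs
  imports "HOL-Analysis.Analysis"
begin

definition lipschitz_near :: "('a::real_normed_vector \<Rightarrow> real) \<Rightarrow> 'a \<Rightarrow> bool" where
  "lipschitz_near f x \<longleftrightarrow> (\<exists>r>0. \<exists>L. L-lipschitz_on (ball x r) f)"

definition locally_lipschitz :: "('a::real_normed_vector \<Rightarrow> real) \<Rightarrow> bool" where
  "locally_lipschitz f \<longleftrightarrow> (\<forall>x. lipschitz_near f x)"

(* The base point y ranges over full neighbourhoods of x, so y = x is allowed.
   The limsup is taken in ereal; it is finite whenever f is Lipschitz near x. *)
definition clarke_dd :: "('a::real_normed_vector \<Rightarrow> real) \<Rightarrow> 'a \<Rightarrow> 'a \<Rightarrow> ereal" where
  "clarke_dd f x h =
     Limsup (nhds x \<times>\<^sub>F at_right 0) (\<lambda>(y, t). ereal ((f (y + t *\<^sub>R h) - f y) / t))"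

definition clarke_gradient :: "('a::real_normed_vector \<Rightarrow> real) \<Rightarrow> 'a \<Rightarrow> ('a \<Rightarrow>\<^sub>L real) set" where
  "clarke_gradient f x = {a. \<forall>h. ereal (blinfun_apply a h) \<le> clarke_dd f x h}"

(* On the dual space, the strong operator topology (pointwise convergence of
   functionals) is exactly the weak-star topology. *)
abbreviation weak_star :: "('a::real_normed_vector \<Rightarrow>\<^sub>L real) topology" where
  "weak_star \<equiv> strong_operator_topology"

definition clarke_gradient_on :: "('a::real_normed_vector \<Rightarrow> real) \<Rightarrow> 'a set \<Rightarrow> ('a \<Rightarrow>\<^sub>L real) set" where
  "clarke_gradient_on f A = weak_star closure_of (convex hull (\<Union>y\<in>A. clarke_gradient f y))"

end

theory Submission
  imports Defs
begin

text \<open>If \<open>0 \<notin> \<partial>f(x)\<close>, then by definition \<open>f\<^sup>0(x;h) < c < 0\<close> for some direction \<open>h\<close>. The difference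
  quotients in direction \<open>h\<close> stay below \<open>c\<close> at all points near \<open>x\<close>, so the gradients there lie in
  the half-space \<open>{a. a h \<le> c}\<close>, which is convex and weak-star closed and hence contains the gradient
  on every small set around \<open>x\<close>; compactness of \<open>A\<close> makes the bound uniform. The minimum is attained
  because gradients are nonempty (Hahn-Banach, applied to the sublinear function \<open>f\<^sup>0(x;\<cdot>)\<close>) and
  norm balls of the dual are weak-star compact.\<close>

section \<open>Linear functionals below a sublinear one\<close>

text \<open>Homogeneity is asked for strictly positive factors only; the value at 0 then follows
  from \<open>p 0 = 2 * p 0\<close>.\<close>

definition sublinear :: "('a::real_vector \<Rightarrow> real) \<Rightarrow> bool" where
  "sublinear p \<longleftrightarrow>
     (\<forall>x y. p (x + y) \<le> p x + p y) \<and> (\<forall>s>0. \<forall>x. p (s *\<^sub>R x) = s * p x)"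

lemma sublinear_add: "sublinear p \<Longrightarrow> p (x + y) \<le> p x + p y"
  by (simp add: sublinear_def)

lemma sublinear_scaleR: "sublinear p \<Longrightarrow> s > 0 \<Longrightarrow> p (s *\<^sub>R x) = s * p x"
  by (simp add: sublinear_def)

lemma sublinear_zero: "sublinear p \<Longrightarrow> p 0 = 0"
  using sublinear_scaleR[of p 2 0] by simp

lemma sublinear_minus: "sublinear p \<Longrightarrow> - p (- x) \<le> p x"
  using sublinear_add[of p x "- x"] by (simp add: sublinear_zero)

text \<open>The reverse inequality for homogeneity is the assumed one applied to
  \<open>inverse s\<close> and \<open>s *\<^sub>R x\<close>.\<close>

lemma sublinearI:
  assumes "\<And>x y. p (x + y) \<le> p x + p y"
    and le: "\<And>s x. s > 0 \<Longrightarrow> p (s *\<^sub>R x) \<le> s * p x"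
  shows "sublinear p"
proof -
  have "s * p x \<le> p (s *\<^sub>R x)" if "s > 0" for s x
    using le[of "inverse s" "s *\<^sub>R x"] that by (simp add: field_simps)
  then show ?thesis
    using assms unfolding sublinear_def by (meson order_antisym)
qed

text \<open>This supplies the lower bounds of chains in Zorn's lemma. Subadditivity passes to the
  infimum because the smaller of two members \<open>q\<close> and \<open>r\<close> lies below
  both.\<close>

lemma sublinear_chain_INF:
  fixes C :: "('a::real_vector \<Rightarrow> real) set"
  assumes "C \<noteq> {}" and sub: "\<And>q. q \<in> C \<Longrightarrow> sublinear q"
    and chain: "\<And>q r. q \<in> C \<Longrightarrow> r \<in> C \<Longrightarrow> q \<le> r \<or> r \<le> q"
    and bdd: "\<And>x. bdd_below ((\<lambda>q. q x) ` C)"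
  shows "sublinear (\<lambda>x. INF q\<in>C. q x)"
proof (rule sublinearI)
  fix x y
  let ?u = "\<lambda>x. INF q\<in>C. q x"
  have "?u (x + y) \<le> q x + r y" if "q \<in> C" "r \<in> C" for q r
  proof -
    obtain s where s: "s \<in> C" "s \<le> q" "s \<le> r"
      using chain[OF \<open>q \<in> C\<close> \<open>r \<in> C\<close>] \<open>q \<in> C\<close> \<open>r \<in> C\<close> by blast
    have "?u (x + y) \<le> s (x + y)"
      by (intro cINF_lower bdd s)
    also have "\<dots> \<le> s x + s y"
      by (simp add: s sub sublinear_add)
    also have "\<dots> \<le> q x + r y"
      using s by (simp add: add_mono le_funD)
    finally show ?thesis .
  qed
  then have "?u (x + y) - r y \<le> ?u x" if "r \<in> C" for r
    using that \<open>C \<noteq> {}\<close> by (intro cINF_greatest) (auto simp: algebra_simps)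
  then have "?u (x + y) - ?u x \<le> ?u y"
    using \<open>C \<noteq> {}\<close> by (intro cINF_greatest) (auto simp: algebra_simps)
  then show "?u (x + y) \<le> ?u x + ?u y" by simp
next
  fix s :: real and x
  let ?u = "\<lambda>x. INF q\<in>C. q x"
  assume "s > 0"
  have "?u (s *\<^sub>R x) / s \<le> q x" if "q \<in> C" for q
    using cINF_lower[OF bdd that, of "s *\<^sub>R x"] \<open>s > 0\<close> sublinear_scaleR[OF sub[OF that], of s x]
    by (simp add: field_simps)
  then have "?u (s *\<^sub>R x) / s \<le> ?u x"
    using \<open>C \<noteq> {}\<close> by (intro cINF_greatest) auto
  then show "?u (s *\<^sub>R x) \<le> s * ?u x"
    using \<open>s > 0\<close> by (simp add: field_simps)
qed

lemma minimal_sublinear_exists: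
  assumes p: "sublinear p"
  obtains m where "sublinear m" "m \<le> p" "\<And>q. sublinear q \<Longrightarrow> q \<le> m \<Longrightarrow> q = m"
proof -
  define A where "A = {q. sublinear q \<and> q \<le> p}"
  \<comment> \<open>Zorn's lemma yields maximal elements; with the reversed order these are the
    minimal ones.\<close>
  have "\<exists>m\<in>A. \<forall>q\<in>A. m \<ge> q \<longrightarrow> q = m"
  proof (rule predicate_Zorn)
    show "partial_order_on A (relation_of (\<ge>) A)"
      by (auto simp: partial_order_on_def preorder_on_def refl_on_def trans_def antisym_def
          relation_of_def)
  next
    fix C assume C: "C \<in> Chains (relation_of (\<ge>) A)"
    show "\<exists>u\<in>A. \<forall>q\<in>C. q \<ge> u"
    proof (cases "C = {}")
      case True
      then show ?thesis using p by (auto simp: A_def)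
    next
      case False
      have CA: "C \<subseteq> A" and chain: "\<And>q r. q \<in> C \<Longrightarrow> r \<in> C \<Longrightarrow> q \<le> r \<or> r \<le> q"
        using C by (auto simp: Chains_def relation_of_def)
      \<comment> \<open>The bound \<open>q x \<ge> - q (- x) \<ge> - p (- x)\<close> is uniform in
        \<open>q\<close>, so the pointwise infimum over the chain is finite.\<close>
      have bdd: "bdd_below ((\<lambda>q. q x) ` C)" for x
      proof (rule bdd_belowI2)
        fix q assume "q \<in> C"
        then have "sublinear q" "q (- x) \<le> p (- x)"
          using CA by (auto simp: A_def le_fun_def)
        then show "- p (- x) \<le> q x"
          using sublinear_minus[of q x] by simp
      qed
      let ?u = "\<lambda>x. INF q\<in>C. q x"
      have "sublinear ?u"
        using sublinear_chain_INF[OF False _ chain bdd] CA by (auto simp: A_def)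
      moreover have lower: "?u \<le> q" if "q \<in> C" for q
        using cINF_lower[OF bdd that] by (simp add: le_fun_def)
      moreover have "?u \<le> p"
      proof -
        obtain q where "q \<in> C" using False by blast
        then have "?u \<le> q" "q \<le> p" using lower CA by (auto simp: A_def)
        then show ?thesis by (rule order_trans)
      qed
      ultimately show ?thesis by (auto simp: A_def)
    qed
  qed
  then obtain m where m: "m \<in> A" and min: "\<And>q. q \<in> A \<Longrightarrow> q \<le> m \<Longrightarrow> q = m"
    by blast
  show thesis
  proof (rule that)
    show "sublinear m" "m \<le> p" using m by (auto simp: A_def)
    fix q assume q: "sublinear q" "q \<le> m"
    have "q \<le> p" using q(2) \<open>m \<le> p\<close> by (rule order_trans)
    then show "q = m" using q by (intro min) (auto simp: A_def)
  qed
qed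

text \<open>A sublinear functional \<open>m\<close> can be decreased along any direction \<open>y\<close> to the sublinear
  functional \<open>x \<mapsto> inf\<^bsub>t \<ge> 0\<^esub> m (x + t y) - t m y\<close>, so a minimal one satisfies
  \<open>m x + m y \<le> m (x + y)\<close>.\<close>

lemma minimal_sublinear_linear:
  assumes m: "sublinear m" and min: "\<And>q. sublinear q \<Longrightarrow> q \<le> m \<Longrightarrow> q = m"
  shows "linear m"
proof -
  have superadd: "m x + m y \<le> m (x + y)" for x y
  proof -
    define d where "d = (\<lambda>x t. m (x + t *\<^sub>R y) - t * m y)"
    define q where "q = (\<lambda>x. INF t\<in>{0..}. d x t)"
    have ms: "m (t *\<^sub>R y) = t * m y" if "t \<ge> 0" for t
      using that m by (cases "t = 0") (auto simp: sublinear_scaleR sublinear_zero)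
    \<comment> \<open>From \<open>t * m y = m (t *\<^sub>R y) \<le> m (x + t *\<^sub>R y) + m (-
      x)\<close> comes a lower bound independent of \<open>t\<close>.\<close>
    have bdd: "bdd_below (d x ` {0..})" for x
    proof (rule bdd_belowI2)
      fix t :: real assume "t \<in> {0..}"
      then show "- m (- x) \<le> d x t"
        using sublinear_add[OF m, of "x + t *\<^sub>R y" "- x"] ms[of t] by (simp add: d_def)
    qed
    have lower: "q x \<le> d x t" if "t \<ge> 0" for x t
      unfolding q_def using that by (intro cINF_lower bdd) auto
    have greatest: "c \<le> q x" if "\<And>t. t \<ge> 0 \<Longrightarrow> c \<le> d x t" for c x
      unfolding q_def using that by (intro cINF_greatest) auto
    have "sublinear q"
    proof (rule sublinearI)
      fix x z
      have "q (x + z) \<le> d x s + d z t" if "s \<ge> 0" "t \<ge> 0" for s t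
      proof -
        \<comment> \<open>The parameters are added, so that the two shifts along \<open>y\<close>
          combine into one.\<close>
        have "q (x + z) \<le> d (x + z) (s + t)"
          using that by (intro lower) auto
        also have "\<dots> \<le> d x s + d z t"
          using sublinear_add[OF m, of "x + s *\<^sub>R y" "z + t *\<^sub>R y"]
          by (simp add: d_def algebra_simps)
        finally show ?thesis .
      qed
      then have "q (x + z) - d z t \<le> q x" if "t \<ge> 0" for t
        using that by (intro greatest) (auto simp: algebra_simps)
      then have "q (x + z) - q x \<le> q z"
        by (intro greatest) (auto simp: algebra_simps)
      then show "q (x + z) \<le> q x + q z" by simp
    next
      fix s :: real and x assume s: "s > 0"
      have "q (s *\<^sub>R x) / s \<le> d x t" if "t \<ge> 0" for t
      proof -
        have "q (s *\<^sub>R x) \<le> d (s *\<^sub>R x) (s * t)"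
          using that s by (intro lower) auto
        also have "\<dots> = s * d x t"
          using sublinear_scaleR[OF m s, of "x + t *\<^sub>R y"] by (simp add: d_def algebra_simps)
        finally show ?thesis using s by (simp add: field_simps)
      qed
      then have "q (s *\<^sub>R x) / s \<le> q x" by (rule greatest)
      then show "q (s *\<^sub>R x) \<le> s * q x" using s by (simp add: field_simps)
    qed
    \<comment> \<open>The parameter 0 gives \<open>q \<le> m\<close>; once \<open>q = m\<close>, the
      parameter 1 gives superadditivity.\<close>
    moreover have "q \<le> m"
      using lower[of 0] by (simp add: le_fun_def d_def)
    ultimately have "q = m" by (rule min)
    then show ?thesis using lower[of 1 x] by (simp add: d_def)
  qed
  then have add: "m (x + y) = m x + m y" for x y
    using sublinear_add[OF m] by (simp add: order_antisym)
  then have neg: "m (- x) = - m x" for x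
    using add[of x "- x"] sublinear_zero[OF m] by simp
  have "m (s *\<^sub>R x) = s * m x" for s x
  proof (cases s "0 :: real" rule: linorder_cases)
    case less
    then show ?thesis using sublinear_scaleR[OF m, of "- s" x] neg[of "s *\<^sub>R x"] by simp
  next
    case equal
    then show ?thesis by (simp add: sublinear_zero[OF m])
  next
    case greater
    then show ?thesis by (rule sublinear_scaleR[OF m])
  qed
  then show ?thesis by (intro linearI) (auto simp: add)
qed

text \<open>A form of the Hahn-Banach theorem: a minimal sublinear functional below \<open>p\<close>
  is already linear.\<close>

theorem linear_below_sublinear:
  assumes "sublinear p"
  obtains g where "linear g" "g \<le> p"
proof -
  obtain m where "sublinear m" "m \<le> p" "\<And>q. sublinear q \<Longrightarrow> q \<le> m \<Longrightarrow> q = m"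
    using minimal_sublinear_exists[OF assms] by blast
  then show thesis using that minimal_sublinear_linear by blast
qed

section \<open>The weak-star topology\<close>

lemma closedin_weak_star_halfspace: "closedin weak_star {a. blinfun_apply a h \<le> c}"
proof -
  have "closedin weak_star {a \<in> topspace weak_star. blinfun_apply a h \<in> {..c}}"
    by (rule closedin_continuous_map_preimage[OF strong_operator_topology_continuous_evaluation])
      simp
  then show ?thesis by (simp add: strong_operator_topology_topspace)
qed

text \<open>One-sided bounds suffice, since \<open>h\<close> may be replaced by \<open>- h\<close>.
  This presents the dual ball as an intersection of half-spaces, hence as a weak-star closed
  set.\<close>

lemma norm_blinfun_le_iff:
  fixes a :: "'a::real_normed_vector \<Rightarrow>\<^sub>L real"
  assumes "r \<ge> 0"
  shows "norm a \<le> r \<longleftrightarrow> (\<forall>h. blinfun_apply a h \<le> r * norm h)"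
proof safe
  fix h assume "norm a \<le> r"
  then show "blinfun_apply a h \<le> r * norm h"
    using norm_blinfun[of a h] mult_right_mono[of "norm a" r "norm h"] by simp
next
  assume *: "\<forall>h. blinfun_apply a h \<le> r * norm h"
  show "norm a \<le> r"
  proof (rule norm_blinfun_bound[OF assms])
    fix h
    show "norm (blinfun_apply a h) \<le> r * norm h"
      using *[rule_format, of h] *[rule_format, of "- h"] by (simp add: blinfun.minus_right)
  qed
qed

lemma closedin_weak_star_cball: "closedin weak_star (cball 0 r)"
proof (cases "r \<ge> 0")
  case True
  then have "cball 0 r = (\<Inter>h. {a :: 'a \<Rightarrow>\<^sub>L real. blinfun_apply a h \<le> r * norm h})"
    by (auto simp: norm_blinfun_le_iff)
  then show ?thesis
    by (auto intro!: closedin_Inter closedin_weak_star_halfspace)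
qed simp

text \<open>By Tychonoff the product of the intervals \<open>cball 0 (r * norm h)\<close> is
  compact. Linearity is a closed condition on it, and \<open>Blinfun\<close> maps the resulting
  compact set \<open>K\<close> continuously onto the dual ball.\<close>

theorem Banach_Alaoglu: "compactin weak_star (cball 0 r)"
proof (cases "r \<ge> 0")
  case True
  define K where "K = {g :: 'a \<Rightarrow> real. linear g \<and> (\<forall>h. g h \<in> cball 0 (r * norm h))}"
  have "compactin (product_topology (\<lambda>_::'a. euclidean :: real topology) UNIV)
      (PiE UNIV (\<lambda>h. cball 0 (r * norm h)))"
    by (subst compactin_PiE) (simp del: PiE_UNIV_domain)
  then have "compact (PiE UNIV (\<lambda>h::'a. cball (0::real) (r * norm h)))"
    unfolding euclidean_product_topology by simp
  moreover have "closed {g :: 'a \<Rightarrow> real. linear g}"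
  proof -
    have "{g :: 'a \<Rightarrow> real. linear g} =
        {g. \<forall>x y. g (x + y) = g x + g y} \<inter> {g. \<forall>s x. g (s *\<^sub>R x) = s * g x}"
      by (auto simp: linear_iff)
    then show ?thesis
      by (auto intro!: closed_Int closed_Collect_all closed_Collect_eq continuous_intros)
  qed
  moreover have "K = PiE UNIV (\<lambda>h::'a. cball (0::real) (r * norm h)) \<inter> {g. linear g}"
    by (auto simp: K_def)
  ultimately have "compact K"
    by (simp add: compact_Int_closed)
  have K: "blinfun_apply (Blinfun g) = g" if "g \<in> K" for g
  proof (rule bounded_linear_Blinfun_apply)
    show "bounded_linear g"
      using that by (intro bounded_linear_intro[of g r])
        (auto simp: K_def linear_add linear_scale mult.commute)
  qed
  \<comment> \<open>Weak-star continuity is tested at each \<open>h\<close> separately; on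
    \<open>K\<close>, evaluation of \<open>Blinfun g\<close> at \<open>h\<close> is a coordinate
    projection.\<close>
  have "continuous_map (top_of_set K) weak_star Blinfun"
    unfolding continuous_on_strong_operator_topo_iff_coordinatewise
  proof
    fix h
    have "continuous_on K (\<lambda>g. g h)"
      by (rule continuous_on_subset[OF continuous_on_product_coordinates]) simp
    then have "continuous_on K (\<lambda>g. blinfun_apply (Blinfun g) h)"
      by (simp add: K cong: continuous_on_cong)
    then show "continuous_map (top_of_set K) euclidean (\<lambda>g. blinfun_apply (Blinfun g) h)"
      by simp
  qed
  moreover have "compactin (top_of_set K) K"
    using \<open>compact K\<close> by (simp add: compactin_subtopology)
  ultimately have "compactin weak_star (Blinfun ` K)"
    by (rule image_compactin[rotated])
  moreover have "Blinfun ` K = cball 0 r"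
  proof safe
    fix g assume "g \<in> K"
    then show "Blinfun g \<in> cball 0 r"
      using K[OF \<open>g \<in> K\<close>] True by (auto simp: norm_blinfun_le_iff K_def abs_le_iff)
  next
    fix a :: "'a \<Rightarrow>\<^sub>L real" assume a: "a \<in> cball 0 r"
    have "\<bar>blinfun_apply a h\<bar> \<le> r * norm h" for h
      using norm_blinfun[of a h] a mult_right_mono[of "norm a" r "norm h"] by simp
    then have "blinfun_apply a \<in> K"
      by (simp add: K_def bounded_linear.linear blinfun.bounded_linear_right)
    then show "a \<in> Blinfun ` K"
      by (metis blinfun_apply_inverse image_eqI)
  qed
  ultimately show ?thesis by simp
qed simp

text \<open>For \<open>r > m\<close>, with \<open>m\<close> the infimum of the norms, the balls of
  radius \<open>r\<close> are weak-star closed and meet \<open>C\<close>. Compactness of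
  \<open>C \<inter> cball 0 (m + 1)\<close> gives a point common to all of them, whose norm is at
  most \<open>m\<close>.\<close>

lemma weak_star_closed_attains_min_norm:
  assumes C: "closedin weak_star C" and "C \<noteq> {}"
  shows "\<exists>a. is_arg_min norm (\<lambda>b. b \<in> C) a"
proof -
  define m where "m = (INF a\<in>C. norm a)"
  have lower: "m \<le> norm a" if "a \<in> C" for a
    unfolding m_def using that by (intro cINF_lower bdd_belowI2[of _ 0]) auto
  have approx: "\<exists>a\<in>C. norm a < r" if "r > m" for r
    using that \<open>C \<noteq> {}\<close> unfolding m_def
    by (subst (asm) cINF_less_iff) (auto intro!: bdd_belowI2[of _ 0])
  have "compactin weak_star (C \<inter> cball 0 (m + 1))"
    by (rule closed_Int_compactin[OF C Banach_Alaoglu])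
  moreover have "(C \<inter> cball 0 (m + 1)) \<inter> \<Inter>F \<noteq> {}"
    if F: "finite F" "F \<subseteq> cball 0 ` {m<..}" for F
  proof -
    obtain R where R: "finite R" "R \<subseteq> {m<..}" "F = cball 0 ` R"
      using finite_subset_image[OF F] by blast
    \<comment> \<open>Including \<open>m + 1\<close> puts the chosen point into the compact set as
      well, and covers an empty \<open>R\<close>.\<close>
    then have "Min (insert (m + 1) R) > m" by auto
    then obtain a where a: "a \<in> C" "norm a < Min (insert (m + 1) R)"
      using approx by blast
    with R have "a \<in> (C \<inter> cball 0 (m + 1)) \<inter> \<Inter>F" by auto
    then show ?thesis by blast
  qed
  ultimately have "(C \<inter> cball 0 (m + 1)) \<inter> \<Inter>(cball 0 ` {m<..}) \<noteq> {}"
    unfolding compactin_fip by (auto simp: closedin_weak_star_cball)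
  then obtain a where "a \<in> C" and "a \<in> \<Inter>(cball 0 ` {m<..})"
    by blast
  then have "norm a \<le> r" if "r > m" for r
    using that by auto
  then have "norm a \<le> m" by (rule dense_ge)
  then have "is_arg_min norm (\<lambda>b. b \<in> C) a"
    using lower \<open>a \<in> C\<close> unfolding is_arg_min_linorder by (meson order_trans)
  then show ?thesis ..
qed

section \<open>Clarke's directional derivative and gradient\<close>

lemma eventually_nhds_times_at_right_0:
  fixes x :: "'a::metric_space"
  shows "eventually P (nhds x \<times>\<^sub>F at_right (0::real)) \<longleftrightarrow>
    (\<exists>d>0. \<forall>y t. dist y x < d \<longrightarrow> 0 < t \<longrightarrow> t < d \<longrightarrow> P (y, t))"
proof
  assume "eventually P (nhds x \<times>\<^sub>F at_right (0::real))"
  then obtain Q R where QR: "eventually Q (nhds x)" "eventually R (at_right (0::real))"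
    "\<And>y t. Q y \<Longrightarrow> R t \<Longrightarrow> P (y, t)"
    by (auto simp: eventually_prod_filter)
  obtain d where d: "d > 0" "\<And>y. dist y x < d \<Longrightarrow> Q y"
    using QR(1) by (auto simp: eventually_nhds_metric)
  obtain e where e: "e > 0" "\<And>t. 0 < t \<Longrightarrow> t < e \<Longrightarrow> R t"
    using QR(2) by (auto simp: eventually_at_right_field)
  show "\<exists>d>0. \<forall>y t. dist y x < d \<longrightarrow> 0 < t \<longrightarrow> t < d \<longrightarrow> P (y, t)"
    using d e QR(3) by (intro exI[of _ "min d e"]) auto
next
  assume "\<exists>d>0. \<forall>y t. dist y x < d \<longrightarrow> 0 < t \<longrightarrow> t < d \<longrightarrow> P (y, t)"
  then obtain d where d: "d > 0" "\<And>y t. dist y x < d \<Longrightarrow> 0 < t \<Longrightarrow> t < d \<Longrightarrow> P (y, t)"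
    by blast
  have "eventually (\<lambda>y. dist y x < d) (nhds x)"
    using d(1) by (auto simp: eventually_nhds_metric)
  moreover have "eventually (\<lambda>t. 0 < t \<and> t < d) (at_right (0::real))"
    using d(1) by (auto simp: eventually_at_right_field)
  ultimately show "eventually P (nhds x \<times>\<^sub>F at_right (0::real))"
    unfolding eventually_prod_filter using d(2)
    by (intro exI[of _ "\<lambda>y. dist y x < d"] exI[of _ "\<lambda>t. 0 < t \<and> t < d"]) auto
qed

lemma clarke_dd_leI:
  assumes "d > 0"
    and "\<And>y t. dist y x < d \<Longrightarrow> 0 < t \<Longrightarrow> t < d \<Longrightarrow> (f (y + t *\<^sub>R h) - f y) / t \<le> c"
  shows "clarke_dd f x h \<le> ereal c"
  unfolding clarke_dd_def
  by (rule Limsup_bounded) (use assms in \<open>auto simp: eventually_nhds_times_at_right_0\<close>)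

text \<open>An eventual lower bound passes to the limsup because the filter is proper.\<close>

lemma clarke_dd_geI:
  assumes "d > 0"
    and "\<And>y t. dist y x < d \<Longrightarrow> 0 < t \<Longrightarrow> t < d \<Longrightarrow> c \<le> (f (y + t *\<^sub>R h) - f y) / t"
  shows "ereal c \<le> clarke_dd f x h"
  unfolding clarke_dd_def
  by (rule le_Limsup)
    (use assms in \<open>auto simp: eventually_nhds_times_at_right_0 prod_filter_eq_bot\<close>)

lemma clarke_dd_lessD:
  assumes "clarke_dd f x h < ereal c"
  obtains d where "d > 0"
    "\<And>y t. dist y x < d \<Longrightarrow> 0 < t \<Longrightarrow> t < d \<Longrightarrow> (f (y + t *\<^sub>R h) - f y) / t < c"
  using Limsup_lessD[OF assms[unfolded clarke_dd_def]]
  by (auto simp: eventually_nhds_times_at_right_0)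

text \<open>Used to keep the moved point of a difference quotient inside a prescribed ball about
  \<open>x\<close>.\<close>

lemma dist_add_scaleR_less:
  fixes x h :: "'a::real_normed_vector"
  assumes "r > 0"
  obtains d where "0 < d" "d \<le> r"
    "\<And>y t. dist y x < d \<Longrightarrow> 0 < t \<Longrightarrow> t < d \<Longrightarrow> dist (y + t *\<^sub>R h) x < r"
proof
  let ?d = "r / (2 + norm h)"
  have pos: "2 + norm h > 0" by (simp add: add_pos_nonneg)
  then show "0 < ?d" using assms by simp
  show "?d \<le> r"
    using mult_left_mono[of 1 "2 + norm h" r] assms pos by (simp add: pos_divide_le_eq)
  fix y t assume yt: "dist y x < ?d" "0 < t" "t < ?d"
  have "dist (y + t *\<^sub>R h) x \<le> dist y x + t * norm h"
    using norm_triangle_ineq[of "y - x" "t *\<^sub>R h"] yt by (simp add: dist_norm algebra_simps)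
  also have "\<dots> < ?d + ?d * norm h"
    using yt by (intro add_less_le_mono mult_right_mono) auto
  also have "\<dots> = ?d * (1 + norm h)" by (simp only: distrib_left mult_1_right)
  also have "\<dots> \<le> r"
    using assms pos by (simp add: pos_divide_le_eq)
  finally show "dist (y + t *\<^sub>R h) x < r" .
qed

text \<open>The Lipschitz estimate bounds the quotients themselves. It makes the extended-real
  derivative finite and later bounds the functional found by Hahn-Banach.\<close>

lemma clarke_dd_bounded:
  assumes "lipschitz_near f x"
  obtains L where "\<And>h. - ereal (L * norm h) \<le> clarke_dd f x h"
    "\<And>h. clarke_dd f x h \<le> ereal (L * norm h)"
proof -
  obtain r L where r: "r > 0" and L: "L-lipschitz_on (ball x r) f"
    using assms by (auto simp: lipschitz_near_def)
  have "- ereal (L * norm h) \<le> clarke_dd f x h \<and> clarke_dd f x h \<le> ereal (L * norm h)" for h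
  proof -
    obtain d where d: "0 < d" "d \<le> r" and
      near: "\<And>y t. dist y x < d \<Longrightarrow> 0 < t \<Longrightarrow> t < d \<Longrightarrow> dist (y + t *\<^sub>R h) x < r"
      using dist_add_scaleR_less[OF r] by blast
    have *: "\<bar>(f (y + t *\<^sub>R h) - f y) / t\<bar> \<le> L * norm h"
      if "dist y x < d" "0 < t" "t < d" for y t
    proof -
      have "y + t *\<^sub>R h \<in> ball x r"
        using near[OF that] by (simp add: dist_commute)
      moreover have "y \<in> ball x r"
        using that d by (simp add: dist_commute)
      ultimately have "\<bar>f (y + t *\<^sub>R h) - f y\<bar> \<le> L * (t * norm h)"
        using lipschitz_onD[OF L, of "y + t *\<^sub>R h" y] that by (simp add: dist_norm)
      then show ?thesis
        using that by (simp add: field_simps)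
    qed
    show ?thesis
      using clarke_dd_leI[OF d(1), of x f h "L * norm h"]
        clarke_dd_geI[OF d(1), of x "- (L * norm h)" f h] * unfolding abs_le_iff
      by (simp add: minus_le_iff)
  qed
  then show thesis using that by blast
qed

text \<open>The increment in direction \<open>h + k\<close> is split at
  \<open>y + t *\<^sub>R h\<close>, which is an admissible base point since the limsup lets base
  points vary. Homogeneity is the substitution of \<open>t * s\<close> for the step.\<close>

lemma clarke_dd_sublinear:
  assumes fin: "\<And>h. clarke_dd f x h = ereal (p h)"
  shows "sublinear p"
proof (rule sublinearI)
  fix h k
  show "p (h + k) \<le> p h + p k"
  proof (rule field_le_epsilon)
    fix e :: real assume "e > 0"
    then have "clarke_dd f x h < ereal (p h + e/2)" "clarke_dd f x k < ereal (p k + e/2)"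
      by (auto simp: fin)
    then obtain d1 d2 where
      d1: "d1 > 0" "\<And>y t. dist y x < d1 \<Longrightarrow> 0 < t \<Longrightarrow> t < d1 \<Longrightarrow>
        (f (y + t *\<^sub>R h) - f y) / t < p h + e/2" and
      d2: "d2 > 0" "\<And>y t. dist y x < d2 \<Longrightarrow> 0 < t \<Longrightarrow> t < d2 \<Longrightarrow>
        (f (y + t *\<^sub>R k) - f y) / t < p k + e/2"
      by (metis clarke_dd_lessD)
    \<comment> \<open>The radius \<open>d'\<close> keeps the intermediate point within
      \<open>d2\<close> of \<open>x\<close>, where the estimate for \<open>k\<close>
      applies.\<close>
    obtain d' where d': "0 < d'" and
      near: "\<And>y t. dist y x < d' \<Longrightarrow> 0 < t \<Longrightarrow> t < d' \<Longrightarrow> dist (y + t *\<^sub>R h) x < d2"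
      and "d' \<le> d2"
      using dist_add_scaleR_less[OF d2(1)] by metis
    define d where "d = min d1 d'"
    have d: "d > 0" "d \<le> d1" "d \<le> d'"
      using d1(1) d'(1) by (auto simp: d_def)
    have "clarke_dd f x (h + k) \<le> ereal (p h + p k + e)"
    proof (rule clarke_dd_leI[OF d(1)])
      fix y t assume yt: "dist y x < d" "0 < t" "t < d"
      let ?z = "y + t *\<^sub>R h"
      have "(f (?z + t *\<^sub>R k) - f ?z) / t < p k + e/2"
        using yt d \<open>d' \<le> d2\<close> by (intro d2(2) near) auto
      moreover have "(f ?z - f y) / t < p h + e/2"
        using yt d by (intro d1(2)) auto
      ultimately have "(f (?z + t *\<^sub>R k) - f ?z) / t + (f ?z - f y) / t < p h + p k + e"
        by simp
      moreover have "(f (?z + t *\<^sub>R k) - f ?z) / t + (f ?z - f y) / t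
          = (f (y + t *\<^sub>R (h + k)) - f y) / t"
        by (simp add: algebra_simps flip: add_divide_distrib)
      ultimately show "(f (y + t *\<^sub>R (h + k)) - f y) / t \<le> p h + p k + e" by simp
    qed
    then show "p (h + k) \<le> p h + p k + e" by (simp add: fin)
  qed
next
  fix s :: real and h assume s: "s > 0"
  have "p (s *\<^sub>R h) / s \<le> p h"
  proof (rule field_le_epsilon)
    fix e :: real assume "e > 0"
    then have "clarke_dd f x h < ereal (p h + e)" by (simp add: fin)
    then obtain d where d: "d > 0" "\<And>y t. dist y x < d \<Longrightarrow> 0 < t \<Longrightarrow> t < d \<Longrightarrow>
        (f (y + t *\<^sub>R h) - f y) / t < p h + e"
      by (metis clarke_dd_lessD)
    have "clarke_dd f x (s *\<^sub>R h) \<le> ereal (s * (p h + e))"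
    \<comment> \<open>The bound \<open>d / s\<close> keeps the rescaled step \<open>t * s\<close>
      below \<open>d\<close>.\<close>
    proof (rule clarke_dd_leI[of "min d (d / s)"])
      show "min d (d / s) > 0" using d s by simp
      fix y t assume yt: "dist y x < min d (d / s)" "0 < t" "t < min d (d / s)"
      then have "(f (y + (t * s) *\<^sub>R h) - f y) / (t * s) < p h + e"
        using s by (intro d(2)) (auto simp: field_simps)
      then show "(f (y + t *\<^sub>R s *\<^sub>R h) - f y) / t \<le> s * (p h + e)"
        using s yt by (simp add: field_simps)
    qed
    then show "p (s *\<^sub>R h) / s \<le> p h + e" using s by (simp add: fin field_simps)
  qed
  then show "p (s *\<^sub>R h) \<le> s * p h" using s by (simp add: field_simps)
qed

text \<open>The linear functional below the derivative is continuous: its upper bound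
  \<open>L * norm h\<close>, used at \<open>h\<close> and at \<open>- h\<close>, bounds its absolute
  value.\<close>

theorem clarke_gradient_nonempty:
  assumes "lipschitz_near f x"
  shows "clarke_gradient f x \<noteq> {}"
proof -
  obtain L where L: "\<And>h. - ereal (L * norm h) \<le> clarke_dd f x h"
    "\<And>h. clarke_dd f x h \<le> ereal (L * norm h)"
    using clarke_dd_bounded[OF assms] by blast
  define p where "p h = real_of_ereal (clarke_dd f x h)" for h
  have p: "clarke_dd f x h = ereal (p h)" for h
    using L[of h] by (cases "clarke_dd f x h") (auto simp: p_def)
  obtain g where g: "linear g" "g \<le> p"
    using linear_below_sublinear[OF clarke_dd_sublinear[OF p]] by blast
  have le: "g h \<le> L * norm h" for h
    using L(2)[of h] g(2) by (auto simp: p le_fun_def intro: order_trans)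
  have "bounded_linear g"
  proof (rule bounded_linear_intro)
    fix h
    show "norm (g h) \<le> norm h * L"
      using le[of h] le[of "- h"] by (simp add: linear_neg[OF g(1)] mult.commute abs_le_iff)
  qed (use g(1) in \<open>auto simp: linear_add linear_scale\<close>)
  then have "Blinfun g \<in> clarke_gradient f x"
    using g(2) by (simp add: clarke_gradient_def bounded_linear_Blinfun_apply p le_funD)
  then show ?thesis by blast
qed

section \<open>Gradients on sets: norm minimisers and distance from zero\<close>

lemma clarke_gradient_on_halfspace:
  assumes "\<And>y. y \<in> A \<Longrightarrow> clarke_dd f y h \<le> ereal c" and "a \<in> clarke_gradient_on f A"
  shows "blinfun_apply a h \<le> c"
proof -
  have "convex {a. blinfun_apply a h \<le> c}"
    unfolding convex_def
    by (auto simp: blinfun.add_left blinfun.scaleR_left intro: convex_bound_le)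
  moreover have "(\<Union>y\<in>A. clarke_gradient f y) \<subseteq> {a. blinfun_apply a h \<le> c}"
    using assms(1) by (fastforce simp: clarke_gradient_def dest: order_trans)
  ultimately have "convex hull (\<Union>y\<in>A. clarke_gradient f y) \<subseteq> {a. blinfun_apply a h \<le> c}"
    by (simp add: hull_minimal)
  then have "clarke_gradient_on f A \<subseteq> {a. blinfun_apply a h \<le> c}"
    unfolding clarke_gradient_on_def
    by (rule closure_of_minimal[OF _ closedin_weak_star_halfspace])
  then show ?thesis using assms(2) by blast
qed

lemma clarke_gradient_on_attains_min_norm:
  assumes "locally_lipschitz f" and "A \<noteq> {}"
  shows "\<exists>a. is_arg_min norm (\<lambda>b. b \<in> clarke_gradient_on f A) a"
proof (rule weak_star_closed_attains_min_norm)
  show "closedin weak_star (clarke_gradient_on f A)"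
    by (simp add: clarke_gradient_on_def)
  obtain y a where "y \<in> A" "a \<in> clarke_gradient f y"
    using assms clarke_gradient_nonempty[of f] by (fastforce simp: locally_lipschitz_def)
  then have "a \<in> convex hull (\<Union>y\<in>A. clarke_gradient f y)"
    by (intro hull_inc) auto
  then show "clarke_gradient_on f A \<noteq> {}"
    unfolding clarke_gradient_on_def
    using closure_of_subset[of _ weak_star] by (fastforce simp: strong_operator_topology_topspace)
qed

lemma clarke_gradient_local_lower_bound:
  assumes "0 \<notin> clarke_gradient f x"
  obtains d \<sigma> where "d > 0" "\<sigma> > 0"
    "\<And>B a. B \<subseteq> ball x d \<Longrightarrow> a \<in> clarke_gradient_on f B \<Longrightarrow> \<sigma> \<le> norm a"
proof -
  obtain h where "clarke_dd f x h < 0"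
    using assms by (auto simp: clarke_gradient_def not_le zero_ereal_def)
  \<comment> \<open>The gap between the derivative and \<open>c\<close> lets one bound on the
    quotients hold throughout a ball about \<open>x\<close>, so the same \<open>h\<close> and
    \<open>c\<close> serve all points there.\<close>
  then obtain c where c: "clarke_dd f x h < ereal c" "c < 0"
    using ereal_dense2[of "clarke_dd f x h" 0] by (auto simp: zero_ereal_def)
  obtain d where d: "d > 0" "\<And>y t. dist y x < d \<Longrightarrow> 0 < t \<Longrightarrow> t < d \<Longrightarrow>
      (f (y + t *\<^sub>R h) - f y) / t < c"
    using clarke_dd_lessD[OF c(1)] by metis
  have le: "clarke_dd f y h \<le> ereal c" if "y \<in> ball x d" for y
  proof (rule clarke_dd_leI[of "d - dist y x"])
    show "d - dist y x > 0" using that by (simp add: dist_commute)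
    fix z t assume "dist z y < d - dist y x" "0 < t" "t < d - dist y x"
    then show "(f (z + t *\<^sub>R h) - f z) / t \<le> c"
      using dist_triangle[of z x y] zero_le_dist[of y x] by (intro less_imp_le d(2)) linarith+
  qed
  \<comment> \<open>Since \<open>- c \<le> - a h \<le> norm a * norm h\<close>, dividing by the
    positive number \<open>1 + norm h\<close> gives a bound depending on neither \<open>B\<close>
    nor \<open>a\<close>.\<close>
  have "- c / (1 + norm h) \<le> norm a"
    if "B \<subseteq> ball x d" "a \<in> clarke_gradient_on f B" for B a
  proof -
    have "blinfun_apply a h \<le> c"
      using clarke_gradient_on_halfspace[OF le that(2)] that(1) by blast
    then have "- c \<le> norm a * norm h"
      using norm_blinfun[of a h] by simp
    also have "\<dots> \<le> norm a * (1 + norm h)" by (simp add: mult_left_mono)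
    finally show ?thesis by (subst pos_divide_le_eq) (auto simp: add_pos_nonneg)
  qed
  moreover have "- c / (1 + norm h) > 0"
    using c(2) by (simp add: add_pos_nonneg divide_neg_pos)
  ultimately show thesis using that d(1) by blast
qed

theorem proposition2p14:
  fixes f :: "'a::banach \<Rightarrow> real" and A :: "'a set"
  assumes "locally_lipschitz f"
    and "compact A"
    and "\<And>x. x \<in> A \<Longrightarrow> 0 \<notin> clarke_gradient f x"
  shows "\<exists>\<epsilon>>0. \<exists>\<sigma>>0. \<forall>x\<in>A. \<exists>a.
           is_arg_min norm (\<lambda>b. b \<in> clarke_gradient_on f (cball x \<epsilon>)) a \<and> norm a \<ge> \<sigma>"
proof -
  have "\<forall>x\<in>A. \<exists>d \<sigma>. d > 0 \<and> \<sigma> > 0 \<and>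
      (\<forall>B a. B \<subseteq> ball x d \<longrightarrow> a \<in> clarke_gradient_on f B \<longrightarrow> \<sigma> \<le> norm a)"
    using clarke_gradient_local_lower_bound[OF assms(3)] by metis
  then obtain d \<sigma> where d: "\<And>x. x \<in> A \<Longrightarrow> d x > 0" and \<sigma>: "\<And>x. x \<in> A \<Longrightarrow> \<sigma> x > 0"
    and bound: "\<And>x B a. x \<in> A \<Longrightarrow> B \<subseteq> ball x (d x) \<Longrightarrow> a \<in> clarke_gradient_on f B \<Longrightarrow>
      \<sigma> x \<le> norm a"
    by metis
  \<comment> \<open>Half radii leave room: for \<open>y\<close> in \<open>ball x (d x / 2)\<close>,
    a closed ball about \<open>y\<close> of radius at most \<open>d x / 2\<close> stays inside
    \<open>ball x (d x)\<close>.\<close>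
  have "A \<subseteq> (\<Union>x\<in>A. ball x (d x / 2))"
    using d by force
  then obtain F where F: "F \<subseteq> A" "finite F" "A \<subseteq> (\<Union>x\<in>F. ball x (d x / 2))"
    using compactE_image[OF assms(2), of A "\<lambda>x. ball x (d x / 2)"] by auto
  \<comment> \<open>Inserting 1 keeps both minima defined and positive when \<open>F\<close> is
    empty.\<close>
  define \<epsilon> where "\<epsilon> = Min (insert 1 ((\<lambda>x. d x / 2) ` F))"
  define \<sigma>0 where "\<sigma>0 = Min (insert 1 (\<sigma> ` F))"
  have "\<epsilon> > 0" "\<sigma>0 > 0"
    using F d \<sigma> by (auto simp: \<epsilon>_def \<sigma>0_def)
  moreover have "\<exists>a. is_arg_min norm (\<lambda>b. b \<in> clarke_gradient_on f (cball y \<epsilon>)) a \<and>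
      norm a \<ge> \<sigma>0" if "y \<in> A" for y
  proof -
    obtain x where x: "x \<in> F" "dist x y < d x / 2"
      using subsetD[OF F(3) \<open>y \<in> A\<close>] by auto
    have "\<epsilon> \<le> d x / 2" "\<sigma>0 \<le> \<sigma> x"
      using F(2) x(1) unfolding \<epsilon>_def \<sigma>0_def by (intro Min_le; simp)+
    have "cball y \<epsilon> \<subseteq> ball x (d x)"
    proof
      fix z assume "z \<in> cball y \<epsilon>"
      then show "z \<in> ball x (d x)"
        using x(2) \<open>\<epsilon> \<le> d x / 2\<close> dist_triangle[of x z y] by simp
    qed
    then have "\<sigma>0 \<le> norm a" if "a \<in> clarke_gradient_on f (cball y \<epsilon>)" for a
      using bound[OF subsetD[OF F(1) x(1)] _ that] \<open>\<sigma>0 \<le> \<sigma> x\<close> by simp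
    moreover obtain a where "is_arg_min norm (\<lambda>b. b \<in> clarke_gradient_on f (cball y \<epsilon>)) a"
      using clarke_gradient_on_attains_min_norm[OF assms(1), of "cball y \<epsilon>"] \<open>\<epsilon> > 0\<close> by auto
    ultimately show ?thesis by (auto simp: is_arg_min_def)
  qed
  ultimately show ?thesis by blast
qed

end
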